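(* Let $A\in\mathbb{R}^{m\times n}$ have rank $r$, let $b\in\mathbb{R}^m$, and let $M\in\mathbb{R}^{m\times m}$, $N\in\mathbb{R}^{n\times n}$ be symmetric positive definite with $M^{-1}=L_M^{\top}L_M$ and $N^{-1}=L_N^{\top}L_N$ (Cholesky factorizations). Let $U_A$, $D_A$, $Z$ be given by the normalized GSVD of $\{L_MA,L_N\}$, and let $Z_r$ and $U_{A,r}$ consist of the first $r$ columns of $Z$ and $U_A$, respectively. Let $k\ge 1$ be such that the generalized Golub-Kahan bidiagonalization (gen-GKB) of $A$ with starting vector $b$ does not break down before producing $V_k=(v_1,\dots,v_k)$ (i.e. $\alpha_i,\beta_i\neq 0$ for $1\leq i\leq k$). Then the $k$-th solution subspace $\mathrm{span}\{V_k\}$ satisfies $$\mathrm{span}\{V_k\} = \mathrm{span}\{Z_r D_A^{2i+1}U_{A,r}^{\top}L_M b\}_{i=0}^{k-1}.$$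
   Context: $\mathrm{span}\{\cdot\}$ denotes the subspace spanned by the columns of a matrix or by a group of vectors. For symmetric positive definite $B$, $\|x\|_B=(x^{\top}Bx)^{1/2}$. Normalized GSVD of $\{L_MA,L_N\}$: $L_MA=U_A\Sigma_AZ^{-1}$ and $L_N=U_LZ^{-1}$, where $U_A\in\mathbb{R}^{m\times m}$ and $U_L\in\mathbb{R}^{n\times n}$ are orthogonal, $Z=(z_1,\dots,z_n)\in\mathbb{R}^{n\times n}$ is invertible with $N^{-1}$-orthonormal columns ($Z^{\top}N^{-1}Z=I$), and $\Sigma_A=\begin{pmatrix}D_A&0\\0&0\end{pmatrix}\in\mathbb{R}^{m\times n}$ with $D_A=\mathrm{diag}(\sigma_1,\dots,\sigma_r)$, $\sigma_1\ge\cdots\ge\sigma_r>0$. The generalized singular values are then $\gamma_i=\sigma_i$ for $1\le i\le r$. Gen-GKB: with $A^{*}=NA^{\top}M^{-1}$, vectors $u_i\in\mathbb{R}^m$, $v_i\in\mathbb{R}^n$ and scalars $\alpha_i,\beta_i\ge 0$ are generated by $$\beta_1u_1=b,\qquad \alpha_i v_i = A^{*}u_i-\beta_i v_{i-1},\qquad \beta_{i+1}u_{i+1}=Av_i-\alpha_i u_i\qquad (i=1,2,\dots),$$ with $v_0=0$, where $\alpha_i,\beta_i$ are the normalization constants such that $\|u_i\|_{M^{-1}}=\|v_i\|_{N^{-1}}=1$. *)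

theory Defs
  imports Jordan_Normal_Form.DL_Rank Jordan_Normal_Form.Gauss_Jordan_Elimination
begin

text \<open>
  Matrices and vectors are those of \<open>Jordan_Normal_Form\<close>, so rows, columns and diagonal
  entries are numbered from 0: the entry \<open>\<sigma> i\<close> below is the mathematical $\sigma_{i+1}$.
  The vectors and scalars of the bidiagonalization keep their usual numbering from 1.
\<close>

text \<open>\<open>mat_inverse\<close> returns an option; the value is only meaningful for invertible matrices.\<close>

abbreviation minv :: "real mat \<Rightarrow> real mat" where
  "minv B \<equiv> the (mat_inverse B)"

abbreviation vspan :: "nat \<Rightarrow> real vec set \<Rightarrow> real vec set" where
  "vspan n S \<equiv> LinearCombinations.module.span class_ring (module_vec TYPE(real) n) S"

definition spd :: "nat \<Rightarrow> real mat \<Rightarrow> bool" where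
  "spd n B \<longleftrightarrow> B \<in> carrier_mat n n \<and> B\<^sup>T = B \<and>
     (\<forall>x \<in> carrier_vec n. x \<noteq> 0\<^sub>v n \<longrightarrow> x \<bullet> (B *\<^sub>v x) > 0)"

definition norm_wrt :: "real mat \<Rightarrow> real vec \<Rightarrow> real" where
  "norm_wrt B x = sqrt (x \<bullet> (B *\<^sub>v x))"

text \<open>The factor $L$ of $B = L^{\top} L$ is upper triangular, its transpose being the usual
  lower triangular Cholesky factor.\<close>

definition cholesky :: "nat \<Rightarrow> real mat \<Rightarrow> real mat \<Rightarrow> bool" where
  "cholesky n B L \<longleftrightarrow> L \<in> carrier_mat n n \<and> upper_triangular L \<and>
     (\<forall>i<n. L $$ (i, i) > 0) \<and> B = L\<^sup>T * L"

text \<open>The library's \<open>orthogonal_mat\<close> only asks for nonzero orthogonal columns.\<close>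

definition real_orthogonal :: "nat \<Rightarrow> real mat \<Rightarrow> bool" where
  "real_orthogonal n Q \<longleftrightarrow> Q \<in> carrier_mat n n \<and> Q\<^sup>T * Q = 1\<^sub>m n \<and> Q * Q\<^sup>T = 1\<^sub>m n"

definition first_cols :: "nat \<Rightarrow> real mat \<Rightarrow> real mat" where
  "first_cols r B = mat_of_cols (dim_row B) (take r (cols B))"

definition Sigma_mat :: "nat \<Rightarrow> nat \<Rightarrow> nat \<Rightarrow> (nat \<Rightarrow> real) \<Rightarrow> real mat" where
  "Sigma_mat m n r \<sigma> = four_block_mat (mat_diag r \<sigma>) (0\<^sub>m r (n - r))
                                        (0\<^sub>m (m - r) r) (0\<^sub>m (m - r) (n - r))"

text \<open>Normalized GSVD of the pair $\{G, L\}$, with the columns of $Z$ orthonormal with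
  respect to $N^{-1}$.\<close>

definition normalized_gsvd ::
  "nat \<Rightarrow> nat \<Rightarrow> nat \<Rightarrow> real mat \<Rightarrow> real mat \<Rightarrow> real mat \<Rightarrow>
   real mat \<Rightarrow> real mat \<Rightarrow> real mat \<Rightarrow> (nat \<Rightarrow> real) \<Rightarrow> bool" where
  "normalized_gsvd m n r G L N UA UL Z \<sigma> \<longleftrightarrow>
     r \<le> m \<and> r \<le> n \<and>
     real_orthogonal m UA \<and> real_orthogonal n UL \<and>
     Z \<in> carrier_mat n n \<and> invertible_mat Z \<and>
     Z\<^sup>T * minv N * Z = 1\<^sub>m n \<and>
     (\<forall>i j. i \<le> j \<longrightarrow> j < r \<longrightarrow> \<sigma> j \<le> \<sigma> i) \<and> (\<forall>i<r. \<sigma> i > 0) \<and>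
     G = UA * Sigma_mat m n r \<sigma> * minv Z \<and>
     L = UL * minv Z"

text \<open>The quantities of the bidiagonalization up to $u_k$, $v_k$.  As long as the
  \<open>\<alpha> i\<close> and \<open>\<beta> i\<close> are nonzero they are uniquely determined by these conditions.\<close>

definition gen_gkb ::
  "nat \<Rightarrow> nat \<Rightarrow> real mat \<Rightarrow> real mat \<Rightarrow> real mat \<Rightarrow> real vec \<Rightarrow> nat \<Rightarrow>
   (nat \<Rightarrow> real vec) \<Rightarrow> (nat \<Rightarrow> real vec) \<Rightarrow> (nat \<Rightarrow> real) \<Rightarrow> (nat \<Rightarrow> real) \<Rightarrow> bool" where
  "gen_gkb m n A M N b k u v \<alpha> \<beta> \<longleftrightarrow>
     v 0 = 0\<^sub>v n \<and>
     \<beta> 1 \<cdot>\<^sub>v u 1 = b \<and>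
     (\<forall>i \<in> {1..k}.
        u i \<in> carrier_vec m \<and> v i \<in> carrier_vec n \<and> \<alpha> i \<ge> 0 \<and> \<beta> i \<ge> 0 \<and>
        norm_wrt (minv M) (u i) = 1 \<and> norm_wrt (minv N) (v i) = 1 \<and>
        \<alpha> i \<cdot>\<^sub>v v i = (N * A\<^sup>T * minv M) *\<^sub>v u i - \<beta> i \<cdot>\<^sub>v v (i - 1)) \<and>
     (\<forall>i \<in> {1..<k}. \<beta> (i + 1) \<cdot>\<^sub>v u (i + 1) = A *\<^sub>v v i - \<alpha> i \<cdot>\<^sub>v u i)"

end

theory Submission
  imports Defs
begin

text \<open>
  Let $P = N A^{\top} M^{-1}$ be the adjoint of $A$ for the inner products given by
  $M^{-1}$ and $N^{-1}$.  Eliminating the $u_i$ from the bidiagonalization leaves a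
  three-term recurrence for the $v_i$ with the operator $P A$,
  $$P A\, v_j = \beta_{j+1}\alpha_{j+1} v_{j+1} + (\alpha_j^2 + \beta_{j+1}^2) v_j
     + \alpha_j \beta_j v_{j-1}, \qquad \beta_1 \alpha_1 v_1 = P b$$
  (\<open>gen_gkb_three_term\<close>).  Since the leading coefficients $\beta_{j+1}\alpha_{j+1}$ do not
  vanish, the vectors $v_1, \dots, v_k$ and the Krylov vectors $(P A)^i P b$, $i < k$, are
  related by a triangular system with nonzero diagonal, so they span the same subspace
  (\<open>span_recurrence_eq_krylov\<close>).

  It remains to compute the Krylov vectors.  The normalization $Z^{\top} N^{-1} Z = I$
  says $N = Z Z^{\top}$; inserting the decomposition of $L_M A$ into $P$ cancels $Z^{-1}$
  and gives $P = Z_r D_A U_{A,r}^{\top} L_M$ and $P A Z_r = Z_r D_A^2$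
  (\<open>gsvd_adjoint\<close>).  Hence $P b = Z_r D_A U_{A,r}^{\top} L_M b$, and each further
  application of $P A$ raises the exponent of $D_A$ by two.
\<close>

section \<open>Krylov spaces and triangular recurrences\<close>

lemma (in vec_space) mult_mat_vec_span_subset:
  assumes T: "T \<in> carrier_mat n n" and S: "S \<subseteq> carrier_vec n" and W: "W \<subseteq> carrier_vec n"
    and TS: "\<And>s. s \<in> S \<Longrightarrow> T *\<^sub>v s \<in> span W" and x: "x \<in> span S"
  shows "T *\<^sub>v x \<in> span W"
proof -
  \<comment> \<open>The preimage of a subspace is a subspace, so it suffices that it contains \<open>S\<close>.\<close>
  let ?P = "{y \<in> carrier_vec n. T *\<^sub>v y \<in> span W}"
  have "submodule class_ring ?P V"
  proof (rule submodule.intro)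
    show "Module.module class_ring V" ..
    show "?P \<subseteq> carrier V" by auto
    have "T *\<^sub>v 0\<^sub>v n = 0\<^sub>v n" using T by (intro eq_vecI) auto
    then show "\<zero>\<^bsub>V\<^esub> \<in> ?P"
      using submodule.zero_closed[OF span_is_submodule[of W]] W by simp
  next
    fix y z assume "y \<in> ?P" "z \<in> ?P"
    then show "y \<oplus>\<^bsub>V\<^esub> z \<in> ?P"
      using span_add1[OF W]
      by (auto simp: mult_add_distrib_mat_vec[OF T])
  next
    fix c :: 'a and y assume "y \<in> ?P"
    then show "c \<odot>\<^bsub>V\<^esub> y \<in> ?P"
      using smult_in_span[OF W] by (auto simp: mult_mat_vec[OF T])
  qed
  moreover have "S \<subseteq> ?P" using S TS by auto
  ultimately show ?thesis using span_is_subset x by blast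
qed

text \<open>
  Suppose the spans agree up to \<open>j\<close>.  By the recurrence, \<open>T\<close> maps the common span into
  the span of \<open>g 0, ..., g (j + 1)\<close>, which therefore contains \<open>w (j + 1)\<close>.  By the
  definition of the \<open>w i\<close>, \<open>T\<close> also maps it into the span of \<open>w 0, ..., w (j + 1)\<close>, and
  solving the recurrence for \<open>g (j + 1)\<close>, which needs \<open>c j\<close> to be nonzero, puts that
  vector there.
\<close>

lemma (in vec_space) span_recurrence_eq_krylov:
  assumes T: "T \<in> carrier_mat n n"
    and g: "\<And>j. j < k \<Longrightarrow> g j \<in> carrier_vec n" and w: "\<And>j. w j \<in> carrier_vec n"
    and w0: "w 0 = c0 \<cdot>\<^sub>v g 0" "c0 \<noteq> 0"
    and wT: "\<And>j. w (Suc j) = T *\<^sub>v w j"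
    and c: "\<And>j. Suc j < k \<Longrightarrow> c j \<noteq> 0"
    and h: "\<And>j. Suc j < k \<Longrightarrow> h j \<in> span (g ` {..j})"
    and rec: "\<And>j. Suc j < k \<Longrightarrow> T *\<^sub>v g j = c j \<cdot>\<^sub>v g (Suc j) + h j"
    and j: "j < k"
  shows "span (g ` {..j}) = span (w ` {..j})"
  using j
proof (induction j)
  case 0
  have g0: "g 0 \<in> carrier_vec n" using g 0 by blast
  have "g 0 = inverse c0 \<cdot>\<^sub>v w 0" unfolding w0(1) using w0(2) g0 by (simp add: smult_smult_assoc)
  then have "g 0 \<in> span {w 0}"
    using smult_in_span[of "{w 0}" "w 0"] span_mem[of "{w 0}" "w 0"] w[of 0] by auto
  moreover have "w 0 \<in> span {g 0}" unfolding w0(1)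
    using smult_in_span[of "{g 0}" "g 0"] span_mem[of "{g 0}" "g 0"] g0 by auto
  ultimately show ?case
    using span_subsetI[of "{w 0}" "{g 0}"] span_subsetI[of "{g 0}" "{w 0}"] g0 w[of 0] by auto
next
  case (Suc j)
  let ?G = "\<lambda>j. g ` {..j}" and ?W = "\<lambda>j. w ` {..j}"
  have IH: "span (?G j) = span (?W j)" using Suc by simp
  have Gc: "?G i \<subseteq> carrier_vec n" if "i \<le> Suc j" for i using g that Suc.prems by force
  have Wc: "?W i \<subseteq> carrier_vec n" for i using w by auto
  have G_mono: "span (?G i) \<subseteq> span (?G (Suc j))" if "i \<le> Suc j" for i
    by (rule span_is_monotone) (use that in auto)
  have W_mono: "span (?W i) \<subseteq> span (?W (Suc j))" if "i \<le> Suc j" for i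
    by (rule span_is_monotone) (use that in auto)
  have gm: "g i \<in> span (?G (Suc j))" if "i \<le> Suc j" for i
    using that by (intro span_mem[OF Gc]) auto
  have wm: "w i \<in> span (?W (Suc j))" if "i \<le> Suc j" for i
    using that by (intro span_mem[OF Wc]) auto
  have "w (Suc j) \<in> span (?G (Suc j))"
    unfolding wT
  proof (rule mult_mat_vec_span_subset[OF T, of "?G j"])
    show "w j \<in> span (?G j)" unfolding IH by (intro span_mem[OF Wc]) auto
    fix s assume "s \<in> ?G j"
    then obtain i where i: "i \<le> j" and s: "s = g i" by auto
    have "h i \<in> span (?G (Suc j))" using h[of i] G_mono[of i] i Suc.prems by auto
    moreover have "c i \<cdot>\<^sub>v g (Suc i) \<in> span (?G (Suc j))"
      using i by (intro smult_in_span[OF Gc] gm) auto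
    ultimately show "T *\<^sub>v s \<in> span (?G (Suc j))"
      unfolding s using rec[of i] i Suc.prems span_add1[OF Gc[of "Suc j"]] by auto
  qed (use Gc in auto)
  moreover have "g (Suc j) \<in> span (?W (Suc j))"
  proof -
    have Tg: "T *\<^sub>v g j \<in> span (?W (Suc j))"
    proof (rule mult_mat_vec_span_subset[OF T Wc[of j]])
      show "g j \<in> span (?W j)" unfolding IH[symmetric] by (intro span_mem[OF Gc]) auto
      show "T *\<^sub>v s \<in> span (?W (Suc j))" if "s \<in> ?W j" for s
        using that wm by (auto simp flip: wT)
    qed (use w in auto)
    have hj: "h j \<in> span (?W (Suc j))" using h[of j] Suc.prems W_mono[of j] unfolding IH by auto
    have hc: "h j \<in> carrier_vec n" using hj span_is_subset2[OF Wc[of "Suc j"]] by auto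
    have gc: "g (Suc j) \<in> carrier_vec n" using g Suc.prems by blast
    have "g (Suc j) = inverse (c j) \<cdot>\<^sub>v (T *\<^sub>v g j + (-1) \<cdot>\<^sub>v h j)"
      unfolding rec[OF Suc.prems] using c[OF Suc.prems] gc hc by (intro eq_vecI) auto
    then show ?thesis
      using smult_in_span[OF Wc[of "Suc j"]] span_add1[OF _ Tg, of "(-1) \<cdot>\<^sub>v h j"] hj Wc[of "Suc j"]
      by auto
  qed
  moreover have "?W j \<subseteq> span (?G (Suc j))"
  proof -
    have "?W j \<subseteq> span (?W j)" by (intro subsetI span_mem[OF Wc])
    also have "\<dots> \<subseteq> span (?G (Suc j))" using G_mono[of j] unfolding IH by simp
    finally show ?thesis .
  qed
  moreover have "?G j \<subseteq> span (?W (Suc j))"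
  proof -
    have "?G j \<subseteq> span (?G j)" by (intro subsetI span_mem[OF Gc]) simp_all
    also have "\<dots> \<subseteq> span (?W (Suc j))" using W_mono[of j] unfolding IH by simp
    finally show ?thesis .
  qed
  ultimately have "?W (Suc j) \<subseteq> span (?G (Suc j))" "?G (Suc j) \<subseteq> span (?W (Suc j))"
    by (simp_all only: atMost_Suc image_insert insert_subset simp_thms)
  then show ?case
    using span_subsetI[OF Wc[of "Suc j"]] span_subsetI[OF Gc[OF order.refl]] by (intro equalityI)
qed

section \<open>The bidiagonalization as a three-term recurrence\<close>

text \<open>
  Applying \<open>P\<close> to the step that produces \<open>u'\<close> leaves only the images of \<open>u\<close> and \<open>u'\<close>,
  and the steps that produce \<open>v\<close> and \<open>v'\<close> express these by the \<open>v\<close>-vectors.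
\<close>

lemma gen_gkb_three_term:
  fixes P A :: "real mat"
  assumes P: "P \<in> carrier_mat n m" and A: "A \<in> carrier_mat m n"
    and u: "u \<in> carrier_vec m" "u' \<in> carrier_vec m"
    and v: "v0 \<in> carrier_vec n" "v \<in> carrier_vec n" "v' \<in> carrier_vec n"
    and step_v: "a \<cdot>\<^sub>v v = P *\<^sub>v u - b \<cdot>\<^sub>v v0"
    and step_u: "b' \<cdot>\<^sub>v u' = A *\<^sub>v v - a \<cdot>\<^sub>v u"
    and step_v': "a' \<cdot>\<^sub>v v' = P *\<^sub>v u' - b' \<cdot>\<^sub>v v"
  shows "(P * A) *\<^sub>v v = (b' * a') \<cdot>\<^sub>v v' + ((a * a + b' * b') \<cdot>\<^sub>v v + (a * b) \<cdot>\<^sub>v v0)"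
proof -
  have Pu: "P *\<^sub>v u = a \<cdot>\<^sub>v v + b \<cdot>\<^sub>v v0" using step_v v P u by (auto simp: vec_eq_iff)
  have Pu': "P *\<^sub>v u' = a' \<cdot>\<^sub>v v' + b' \<cdot>\<^sub>v v" using step_v' v P u by (auto simp: vec_eq_iff)
  have Av: "A *\<^sub>v v = b' \<cdot>\<^sub>v u' + a \<cdot>\<^sub>v u" using step_u v A u by (auto simp: vec_eq_iff)
  have "(P * A) *\<^sub>v v = b' \<cdot>\<^sub>v (P *\<^sub>v u') + a \<cdot>\<^sub>v (P *\<^sub>v u)"
    using P A u v by (simp add: assoc_mult_mat_vec[of _ n m _ n] Av mult_add_distrib_mat_vec[of _ n m]
        mult_mat_vec[of _ n m])
  then show ?thesis unfolding Pu Pu' using v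
    by (auto simp: vec_eq_iff algebra_simps)
qed

section \<open>Associativity from dimensions\<close>

text \<open>
  With dimensions in place of carrier sets no intermediate size has to be guessed when
  these laws are used for rewriting, so long products can be reassociated automatically.
\<close>

lemma mult_mat_assoc_dim:
  "dim_col X = dim_row Y \<Longrightarrow> dim_col Y = dim_row W \<Longrightarrow> X * Y * W = X * (Y * W)"
  by (rule assoc_mult_mat[of _ "dim_row X" "dim_col X" _ "dim_col Y" _ "dim_col W"]) auto

lemma mult_mat_vec_assoc_dim:
  "dim_col X = dim_row Y \<Longrightarrow> dim_col Y = dim_vec x \<Longrightarrow> X * Y *\<^sub>v x = X *\<^sub>v (Y *\<^sub>v x)"
  by (rule assoc_mult_mat_vec[of _ "dim_row X" "dim_col X" _ "dim_col Y"]) auto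

section \<open>Matrix inverses and leading columns\<close>

lemma minv_inverse:
  assumes "X \<in> carrier_mat n n" and "det X \<noteq> 0"
  shows "minv X \<in> carrier_mat n n" "X * minv X = 1\<^sub>m n" "minv X * X = 1\<^sub>m n"
proof -
  have "mat_inverse X \<noteq> None"
    using mat_inverse(1)[OF assms(1), of "()"] det_non_zero_imp_unit[OF assms, of "()"] by blast
  then obtain Y where "mat_inverse X = Some Y" by blast
  then show "minv X \<in> carrier_mat n n" "X * minv X = 1\<^sub>m n" "minv X * X = 1\<^sub>m n"
    using mat_inverse(2)[OF assms(1)] by auto
qed

lemma spd_det_nonzero:
  assumes "spd n B"
  shows "det B \<noteq> 0"
proof
  assume "det B = 0"
  then obtain x where "x \<in> carrier_vec n" "x \<noteq> 0\<^sub>v n" "B *\<^sub>v x = 0\<^sub>v n"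
    using det_0_iff_vec_prod_zero_field assms unfolding spd_def by blast
  then show False using assms unfolding spd_def by fastforce
qed

text \<open>
  The first \<open>r\<close> columns of the identity.  Multiplication by this matrix on the right
  selects leading columns, and on both sides of a diagonal matrix it pads with zeros;
  this turns statements on submatrices and blocks into matrix algebra.
\<close>

definition leading_identity :: "nat \<Rightarrow> nat \<Rightarrow> real mat" where
  "leading_identity d r = mat d r (\<lambda>(i, j). if i = j then 1 else 0)"

lemma leading_identity_carrier [simp]: "leading_identity d r \<in> carrier_mat d r"
  by (simp add: leading_identity_def)

lemma first_cols_eq_mult:
  assumes "B \<in> carrier_mat p d" and "r \<le> d"
  shows "first_cols r B = B * leading_identity d r"
proof (rule eq_matI)
  fix i j assume "i < dim_row (B * leading_identity d r)" "j < dim_col (B * leading_identity d r)"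
  then show "first_cols r B $$ (i, j) = (B * leading_identity d r) $$ (i, j)"
    using assms
    by (auto simp: first_cols_def mat_of_cols_def leading_identity_def scalar_prod_def
        if_distrib[of "\<lambda>x. _ * x"] cong: if_cong)
qed (use assms in \<open>auto simp: first_cols_def leading_identity_def\<close>)

lemma leading_identity_orthonormal:
  assumes "r \<le> d"
  shows "(leading_identity d r)\<^sup>T * leading_identity d r = 1\<^sub>m r"
  using assms
  by (intro eq_matI) (auto simp: leading_identity_def scalar_prod_def
      if_distrib[of "\<lambda>x. _ * x"] cong: if_cong)

lemma Sigma_mat_eq_mult:
  assumes "r \<le> m" and "r \<le> n"
  shows "Sigma_mat m n r \<sigma> = leading_identity m r * mat_diag r \<sigma> * (leading_identity n r)\<^sup>T"
proof -
  have "leading_identity m r * mat_diag r \<sigma> =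
      mat m r (\<lambda>(i, j). leading_identity m r $$ (i, j) * \<sigma> j)"
    by (rule mat_diag_mult_right) simp
  then show ?thesis
    using assms
    by (intro eq_matI) (auto simp: Sigma_mat_def leading_identity_def scalar_prod_def mat_diag_def
        if_distrib[of "\<lambda>x. _ * x"] if_distrib[of "\<lambda>x. x * _"] cong: if_cong)
qed

lemma mat_diag_power: "mat_diag r \<sigma> ^\<^sub>m k = mat_diag r (\<lambda>i. \<sigma> i ^ k)"
proof (induction k)
  case 0
  show ?case by (simp add: mat_diag_def one_mat_def) 
next
  case (Suc k)
  then show ?case by (simp add: power_Suc2 del: power_Suc)
qed

lemma mat_diag_square_mult_power:
  fixes \<sigma> :: "nat \<Rightarrow> real"
  shows "mat_diag r \<sigma> * (mat_diag r \<sigma> * mat_diag r \<sigma> ^\<^sub>m (2 * i + 1)) =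
    mat_diag r \<sigma> ^\<^sub>m (2 * Suc i + 1)"
  unfolding mat_diag_power by (simp add: mult.assoc)

section \<open>The weighted adjoint in terms of the normalized GSVD\<close>

text \<open>
  In the coordinates of the GSVD the weighted adjoint is diagonal: with $N = Z Z^{\top}$
  the factor $Z^{\top}$ meets $Z^{-\top}$ from $(L_M A)^{\top}$ and cancels, and of
  the padded matrix of singular values only $D_A$ with the first columns of $Z$ and
  $U_A$ survives.  Likewise $L_M A Z_r = U_{A,r} D_A$, and the second factor $D_A$ in
  the last equation appears because the columns of $U_{A,r}$ are orthonormal.
\<close>

lemma gsvd_adjoint:
  fixes A M N L_M L_N U_A U_L Z :: "real mat" and \<sigma> :: "nat \<Rightarrow> real"
  assumes A: "A \<in> carrier_mat m n" and N: "spd n N" and chol: "cholesky m (minv M) L_M"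
    and gsvd: "normalized_gsvd m n r (L_M * A) L_N N U_A U_L Z \<sigma>"
  defines "P \<equiv> N * A\<^sup>T * minv M" and "D \<equiv> mat_diag r \<sigma>"
    and "Zr \<equiv> first_cols r Z" and "Ur \<equiv> first_cols r U_A"
  shows "P \<in> carrier_mat n m" "P = Zr * (D * (Ur\<^sup>T * L_M))" "P * (A * Zr) = Zr * (D * D)"
proof -
  let ?Em = "leading_identity m r" and ?En = "leading_identity n r"
  define Zi where "Zi = minv Z"
  have r: "r \<le> m" "r \<le> n" and U: "U_A \<in> carrier_mat m m" "U_A\<^sup>T * U_A = 1\<^sub>m m"
    and Z: "Z \<in> carrier_mat n n" and Zorth: "Z\<^sup>T * minv N * Z = 1\<^sub>m n"
    and G: "L_M * A = U_A * Sigma_mat m n r \<sigma> * Zi"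
    using gsvd by (auto simp: normalized_gsvd_def real_orthogonal_def Zi_def)
  have L: "L_M \<in> carrier_mat m m" and M: "minv M = L_M\<^sup>T * L_M"
    using chol by (auto simp: cholesky_def)
  have Nc: "N \<in> carrier_mat n n" using N by (simp add: spd_def)
  note Ni = minv_inverse[OF Nc spd_det_nonzero[OF N]]
  have "det (Z\<^sup>T * minv N) * det Z = 1"
    using det_mult[of "Z\<^sup>T * minv N" n Z] Z Ni(1) Zorth by simp
  then have "det Z \<noteq> 0" by auto
  note Zi = minv_inverse[OF Z this, folded Zi_def]
  have D: "D \<in> carrier_mat r r" by (simp add: D_def)
  have E: "?Em \<in> carrier_mat m r" "?En \<in> carrier_mat n r" by simp_all
  have Zr: "Zr = Z * ?En" and Ur: "Ur = U_A * ?Em"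
    unfolding Zr_def Ur_def using first_cols_eq_mult Z U r by auto
  have Zrc: "Zr \<in> carrier_mat n r" and Urc: "Ur \<in> carrier_mat m r"
    unfolding Zr Ur using Z U E by auto
  note dims = carrier_matD[OF A] carrier_matD[OF Nc] carrier_matD[OF L] carrier_matD[OF Z]
    carrier_matD[OF Zi(1)] carrier_matD[OF Ni(1)] carrier_matD[OF U(1)] carrier_matD[OF D]
    carrier_matD[OF E(1)] carrier_matD[OF E(2)] carrier_matD[OF Zrc] carrier_matD[OF Urc]
  show "P \<in> carrier_mat n m" unfolding P_def M using Nc A L by auto

  \<comment> \<open>A left inverse of a square matrix is also a right inverse; so the normalization
    determines \<open>N\<close>.\<close>
  have "Z * (Z\<^sup>T * minv N) = 1\<^sub>m n"
    by (rule mat_mult_left_right_inverse[OF _ Z Zorth]) (use Z Ni in auto)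
  moreover have "Z * (Z\<^sup>T * minv N) * N = Z * (Z\<^sup>T * (minv N * N))"
    using Z Ni(1) Nc by (simp add: mult_mat_assoc_dim dims)
  ultimately have NZ: "N = Z * Z\<^sup>T" using Ni(3) Z Nc by simp

  have G': "L_M * A = Ur * (D * (?En\<^sup>T * Zi))"
    unfolding G Sigma_mat_eq_mult[OF r] Ur D_def[symmetric]
    by (simp add: mult_mat_assoc_dim dims)
  have DT: "D\<^sup>T = D" unfolding D_def by (intro eq_matI) (auto simp: mat_diag_def)
  have "(L_M * A)\<^sup>T = (D * (?En\<^sup>T * Zi))\<^sup>T * Ur\<^sup>T"
    unfolding G' by (rule transpose_mult[OF Urc]) (use D E Zi in auto)
  also have "(D * (?En\<^sup>T * Zi))\<^sup>T = (?En\<^sup>T * Zi)\<^sup>T * D"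
    using transpose_mult[OF D, of "?En\<^sup>T * Zi" n] DT E Zi by auto
  also have "(?En\<^sup>T * Zi)\<^sup>T = Zi\<^sup>T * ?En"
    using transpose_mult[of "?En\<^sup>T" r n Zi n] E Zi by auto
  finally have GT: "(L_M * A)\<^sup>T = Zi\<^sup>T * ?En * D * Ur\<^sup>T" .
  have ZZi: "Z\<^sup>T * Zi\<^sup>T = 1\<^sub>m n"
    using transpose_mult[OF Zi(1) Z] Zi(3) by simp
  have ZG: "Z * Z\<^sup>T * (Zi\<^sup>T * ?En * D * Ur\<^sup>T) = Zr * (D * Ur\<^sup>T)"
  proof -
    have "Z * Z\<^sup>T * (Zi\<^sup>T * ?En * D * Ur\<^sup>T) = Z * (Z\<^sup>T * (Zi\<^sup>T * (?En * (D * Ur\<^sup>T))))"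
      by (simp add: mult_mat_assoc_dim dims)
    also have "\<dots> = Z * ((Z\<^sup>T * Zi\<^sup>T) * (?En * (D * Ur\<^sup>T)))"
      by (simp add: mult_mat_assoc_dim dims)
    also have "\<dots> = Zr * (D * Ur\<^sup>T)"
      unfolding ZZi Zr using E D Urc by (simp add: mult_mat_assoc_dim dims)
    finally show ?thesis .
  qed
  have "P = N * (A\<^sup>T * L_M\<^sup>T) * L_M"
    unfolding P_def M
    by (simp add: mult_mat_assoc_dim dims)
  also have "A\<^sup>T * L_M\<^sup>T = (L_M * A)\<^sup>T" using transpose_mult[OF L A] by simp
  finally have "P = Zr * (D * Ur\<^sup>T) * L_M" unfolding GT by (simp add: NZ ZG)
  then show P: "P = Zr * (D * (Ur\<^sup>T * L_M))"
    by (simp add: mult_mat_assoc_dim dims)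

  have "Zi * Zr = ?En"
    unfolding Zr using assoc_mult_mat[OF Zi(1) Z E(2)] Zi(3) E by simp
  then have EZ: "?En\<^sup>T * (Zi * Zr) = 1\<^sub>m r" using leading_identity_orthonormal[OF r(2)] by simp
  have LAZ: "(L_M * A) * Zr = Ur * D"
    unfolding G'
    by (simp add: mult_mat_assoc_dim dims EZ right_mult_one_mat[OF D])
  have UU: "Ur\<^sup>T * Ur = 1\<^sub>m r"
  proof -
    have "Ur\<^sup>T * Ur = ?Em\<^sup>T * (U_A\<^sup>T * U_A * ?Em)"
      unfolding Ur transpose_mult[OF U(1) E(1)]
      by (simp add: mult_mat_assoc_dim dims)
    then show ?thesis using U(2) E leading_identity_orthonormal[OF r(1)] by simp
  qed
  have "P * (A * Zr) = Zr * (D * (Ur\<^sup>T * ((L_M * A) * Zr)))"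
    unfolding P
    by (simp add: mult_mat_assoc_dim dims)
  also have "\<dots> = Zr * (D * ((Ur\<^sup>T * Ur) * D))"
    unfolding LAZ using Urc D by (simp add: mult_mat_assoc_dim dims)
  finally show "P * (A * Zr) = Zr * (D * D)" unfolding UU using D by simp
qed

theorem lemma4p1:
  fixes m n r k :: nat
    and A M N L_M L_N U_A U_L Z :: "real mat"
    and \<sigma> :: "nat \<Rightarrow> real"
    and b :: "real vec"
    and u v :: "nat \<Rightarrow> real vec"
    and \<alpha> \<beta> :: "nat \<Rightarrow> real"
  assumes "A \<in> carrier_mat m n" and "vec_space.rank m A = r"
    and "b \<in> carrier_vec m"
    and "spd m M" and "spd n N"
    and "cholesky m (minv M) L_M" and "cholesky n (minv N) L_N"
    and "normalized_gsvd m n r (L_M * A) L_N N U_A U_L Z \<sigma>"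
    and "k \<ge> 1"
    and "gen_gkb m n A M N b k u v \<alpha> \<beta>"
    and "\<forall>i \<in> {1..k}. \<alpha> i \<noteq> 0 \<and> \<beta> i \<noteq> 0"
  shows "vec_space.col_space n (mat_of_cols n (map v [1..<k + 1])) =
    vspan n ((\<lambda>i. (first_cols r Z * (mat_diag r \<sigma> ^\<^sub>m (2 * i + 1)) * (first_cols r U_A)\<^sup>T * L_M) *\<^sub>v b)
      ` {0..k - 1})"
proof -
  interpret vec_space "TYPE(real)" n .
  define P where "P = N * A\<^sup>T * minv M"
  define D where "D = mat_diag r \<sigma>"
  define Zr where "Zr = first_cols r Z"
  define y where "y = (first_cols r U_A)\<^sup>T *\<^sub>v (L_M *\<^sub>v b)"
  define w where "w i = Zr *\<^sub>v ((D ^\<^sub>m (2 * i + 1)) *\<^sub>v y)" for i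
  note adj = gsvd_adjoint[OF assms(1,5,6,8), folded P_def D_def Zr_def]
  note A = assms(1) and b = assms(3)
  have P: "P \<in> carrier_mat n m" by (rule adj(1))
  have Zr: "Zr \<in> carrier_mat n r" and Ur: "first_cols r U_A \<in> carrier_mat m r"
    using assms(8)
    by (auto simp: Zr_def normalized_gsvd_def real_orthogonal_def
        first_cols_eq_mult[of Z n n] first_cols_eq_mult[of U_A m m])
  have L: "L_M \<in> carrier_mat m m" using assms(6) by (simp add: cholesky_def)
  have D: "D \<in> carrier_mat r r" and Dk: "\<And>j. D ^\<^sub>m j \<in> carrier_mat r r"
    by (simp_all add: D_def mat_diag_power)
  have y: "y \<in> carrier_vec r" unfolding y_def using Ur L b by simp
  note dims = carrier_matD[OF A] carrier_matD[OF P] carrier_matD[OF Zr] carrier_matD[OF Ur]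
    carrier_matD[OF L] carrier_matD[OF D] carrier_matD[OF Dk] carrier_vecD[OF b] carrier_vecD[OF y]
  have w_carrier: "w i \<in> carrier_vec n" for i 
    unfolding w_def by (rule mult_mat_vec_carrier[OF Zr mult_mat_vec_carrier[OF Dk y]])
  have w_eq: "(Zr * (D ^\<^sub>m (2 * i + 1)) * (first_cols r U_A)\<^sup>T * L_M) *\<^sub>v b = w i" for i
    unfolding w_def y_def
    by (simp add: mult_mat_vec_assoc_dim dims)

  have v0: "v 0 = 0\<^sub>v n" and u1: "\<beta> 1 \<cdot>\<^sub>v u 1 = b"
    and uc: "\<And>i. 1 \<le> i \<Longrightarrow> i \<le> k \<Longrightarrow> u i \<in> carrier_vec m"
    and vc1: "\<And>i. 1 \<le> i \<Longrightarrow> i \<le> k \<Longrightarrow> v i \<in> carrier_vec n"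
    and step_v: "\<And>i. 1 \<le> i \<Longrightarrow> i \<le> k \<Longrightarrow> \<alpha> i \<cdot>\<^sub>v v i = P *\<^sub>v u i - \<beta> i \<cdot>\<^sub>v v (i - 1)"
    and step_u: "\<And>i. 1 \<le> i \<Longrightarrow> i < k \<Longrightarrow> \<beta> (i + 1) \<cdot>\<^sub>v u (i + 1) = A *\<^sub>v v i - \<alpha> i \<cdot>\<^sub>v u i"
    using assms(10) by (auto simp: gen_gkb_def P_def)
  have vc: "v i \<in> carrier_vec n" if "i \<le> k" for i
    using vc1[of i] v0 that by (cases i) auto
  define h where "h j = (\<alpha> (Suc j) * \<alpha> (Suc j) + \<beta> (j + 2) * \<beta> (j + 2)) \<cdot>\<^sub>v v (Suc j)
    + (\<alpha> (Suc j) * \<beta> (Suc j)) \<cdot>\<^sub>v v j" for j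

  \<comment> \<open>The family starts at \<open>v 1\<close>; the term \<open>v 0 = 0\<close> only makes the recurrence uniform.\<close>
  have "span ((\<lambda>j. v (Suc j)) ` {..k - 1}) = span (w ` {..k - 1})"
  proof (rule span_recurrence_eq_krylov[where T = "P * A" and k = k and h = h
        and c = "\<lambda>j. \<beta> (j + 2) * \<alpha> (j + 2)" and ?c0.0 = "\<beta> 1 * \<alpha> 1"])
    show "P * A \<in> carrier_mat n n" using P A by simp
    show "\<And>j. j < k \<Longrightarrow> v (Suc j) \<in> carrier_vec n" using vc by simp
    show "\<And>j. w j \<in> carrier_vec n" by (rule w_carrier)
    show "w 0 = (\<beta> 1 * \<alpha> 1) \<cdot>\<^sub>v v (Suc 0)"
    proof -
      have "w 0 = P *\<^sub>v b"
        unfolding adj(2) w_def y_def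
        by (simp add: mult_mat_vec_assoc_dim dims)
      also have "\<dots> = \<beta> 1 \<cdot>\<^sub>v (P *\<^sub>v u 1)"
        unfolding u1[symmetric] using uc[of 1] assms(9) P by (simp add: mult_mat_vec)
      also have "P *\<^sub>v u 1 = \<alpha> 1 \<cdot>\<^sub>v v 1"
        using step_v[of 1] v0 assms(9) P uc[of 1] by (auto simp: vec_eq_iff)
      finally show ?thesis by (simp add: smult_smult_assoc)
    qed
    show "\<beta> 1 * \<alpha> 1 \<noteq> 0" using assms(9,11) by simp
    show "w (Suc j) = P * A *\<^sub>v w j" for j
    proof -
      define x where "x = (D ^\<^sub>m (2 * j + 1)) *\<^sub>v y"
      have x: "x \<in> carrier_vec r" unfolding x_def by (rule mult_mat_vec_carrier[OF Dk y])
      have "P * A *\<^sub>v w j = (P * (A * Zr)) *\<^sub>v x"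
        unfolding w_def x_def[symmetric]
        by (simp add: mult_mat_vec_assoc_dim dims carrier_vecD[OF x])
      also have "\<dots> = Zr *\<^sub>v ((D * (D * D ^\<^sub>m (2 * j + 1))) *\<^sub>v y)"
        unfolding adj(3) x_def
        by (simp add: mult_mat_vec_assoc_dim dims)
      finally show ?thesis
        unfolding w_def D_def mat_diag_square_mult_power by simp
    qed
    fix j assume j: "Suc j < k"
    show "\<beta> (j + 2) * \<alpha> (j + 2) \<noteq> 0" using assms(11) j by simp
    show "P * A *\<^sub>v v (Suc j) = (\<beta> (j + 2) * \<alpha> (j + 2)) \<cdot>\<^sub>v v (Suc (Suc j)) + h j"
      using gen_gkb_three_term[OF P A uc[of "j + 1"] uc[of "j + 2"] vc[of j] vc[of "j + 1"]
          vc[of "j + 2"]] step_v[of "j + 1"] step_u[of "j + 1"] step_v[of "j + 2"] j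
      by (simp add: h_def)
    show "h j \<in> span ((\<lambda>j. v (Suc j)) ` {..j})"
    proof -
      let ?S = "(\<lambda>j. v (Suc j)) ` {..j}"
      have S: "?S \<subseteq> carrier_vec n" using vc j by auto
      have "v j \<in> span ?S"
      proof (cases j)
        case 0
        then show ?thesis 
          using v0 submodule.zero_closed[OF span_is_submodule[of ?S]] S by simp
      next
        case (Suc i)
        then show ?thesis by (intro span_mem[OF S]) auto
      qed
      moreover have "v (Suc j) \<in> span ?S" by (intro span_mem[OF S]) auto
      ultimately show ?thesis
        unfolding h_def using span_add1[OF S] smult_in_span[OF S] by simp
    qed
  qed (use assms(9) in simp)
  moreover have "set (cols (mat_of_cols n (map v [1..<k + 1]))) = (\<lambda>j. v (Suc j)) ` {..k - 1}"
  proof -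
    have "set (map v [1..<k + 1]) \<subseteq> carrier_vec n" using vc by auto
    then have "set (cols (mat_of_cols n (map v [1..<k + 1]))) = v ` {1..<k + 1}"
      by (simp only: cols_mat_of_cols set_map set_upt)
    also have "{1..<k + 1} = Suc ` {..k - 1}"
      using assms(9) by (simp add: lessThan_Suc_atMost[symmetric] image_Suc_lessThan
          atLeastLessThanSuc_atLeastAtMost)
    finally show ?thesis by (simp add: image_image)
  qed
  ultimately show ?thesis
    unfolding col_space_def w_eq[unfolded Zr_def D_def] by (simp add: atLeast0AtMost)
qed

end
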